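(* The ensemble average of the field operator of the Navier-Stokes equation (the material derivative $du^i/dt$ of the fluid velocity) has the following form: $$\Big\langle\frac{du^i}{dt}\Big\rangle_E=\Big\langle\frac{\partial u^i}{\partial t}+u^k\frac{\partial u^i}{\partial x^k}\Big\rangle_E=\frac{d\langle u^i\rangle_E}{dt}+\Big\langle u^k\frac{\partial u^i}{\partial x^k}\Big\rangle_E-\langle u^k\rangle_E\frac{\partial\langle u^i\rangle_E}{\partial x^k},$$ where $\big\langle u^j\frac{\partial u^i}{\partial x^j}\big\rangle_E=\big\langle u^j\frac{\partial u^i}{\partial x^j}\big\rangle_E(x^k,t)$ is the single-point second order ensemble correlation function of the fluid velocity $u^i(x^j,t)$ and its spatial derivative $\partial u^i(x^k,t)/\partial x^j$, and the material derivative of the ensemble averaged fluid velocity $\langle u^i\rangle_E(x^j,t)$ is $$\frac{d\langle u^i\rangle_E}{dt}=\frac{\partial\langle u^i\rangle_E}{\partial t}+\langle u^k\rangle_E\frac{\partial\langle u^i\rangle_E}{\partial x^k}.$$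
   Context: $x^i$, $i=1,2,3$, are Cartesian coordinates on three-dimensional Euclidean space and $t$ is time; repeated indices are summed. The cosmological fluid fields, including the components of the fluid velocity $u^i(x^j,t)$, are random fields: each field $f$ has, for all times and positions, a probability density $P_{(x^i,t)}(f)$ of the value $f(x^i,t)$, and correlated fields $f,h$ have joint probability densities $P_{(x^i,t)(y^j,s)}(f,h)$. The ensemble average is $\langle f\rangle_E(x^i,t)=\int_{-\infty}^{+\infty} f\,P_{(x^i,t)}(f)\,df$. The two-point second order ensemble correlation function is $\langle fh\rangle_E(x^i,t;y^j,s)=\int\!\!\int fh\,P_{(x^i,t)(y^j,s)}(f,h)\,df\,dh$ (integrals over $(-\infty,+\infty)$); the single-point one is its value at $(y^j,s)=(x^j,t)$.
   Formalization: Formalized with regularity the text leaves implicit: realizations of u^i have partial derivatives everywhere, the averages of u^i and u^k ∂u^i/∂x^k converge absolutely, and the partial derivatives are locally bounded by an integrable random variable; without such a bound the claim can fail. *)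

theory Defs
  imports "HOL-Probability.Probability"
begin

type_synonym scalar_field = "real^3 \<Rightarrow> real \<Rightarrow> real"
type_synonym vector_field = "real^3 \<Rightarrow> real \<Rightarrow> real^3"

definition vcomp :: "vector_field \<Rightarrow> 3 \<Rightarrow> scalar_field" where
  "vcomp v i x t = v x t $ i"

definition time_deriv :: "scalar_field \<Rightarrow> scalar_field" where
  "time_deriv f x t = deriv (\<lambda>s. f x s) t"

definition space_deriv :: "3 \<Rightarrow> scalar_field \<Rightarrow> scalar_field" where
  "space_deriv k f x t = deriv (\<lambda>s. f (x + s *\<^sub>R axis k 1) t) 0"

definition has_partial_derivs :: "scalar_field \<Rightarrow> real^3 \<Rightarrow> real \<Rightarrow> bool" where
  "has_partial_derivs f x t \<longleftrightarrow>
     (\<lambda>s. f x s) differentiable (at t) \<and>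
     (\<forall>k. (\<lambda>s. f (x + s *\<^sub>R axis k 1) t) differentiable (at 0))"

definition material_deriv :: "vector_field \<Rightarrow> scalar_field \<Rightarrow> scalar_field" where
  "material_deriv v f x t =
     time_deriv f x t + (\<Sum>k\<in>UNIV. vcomp v k x t * space_deriv k f x t)"

text \<open>
  A random field is a family of fields indexed by the outcomes of a probability space \<open>M\<close>.
  The probability density of its value at a point is the Radon--Nikodym derivative of the
  law of that value with respect to Lebesgue measure. It is unique only almost everywhere, but
  the integrals below do not depend on the version. Without a density \<open>RN_deriv\<close> is
  zero by convention, so \<open>has_density\<close> has to be required wherever these integrals are used.
\<close>

definition has_density :: "'w measure \<Rightarrow> 'b measure \<Rightarrow> ('w \<Rightarrow> 'b) \<Rightarrow> bool" where
  "has_density M N X \<longleftrightarrow> (\<exists>p. distributed M N X p)"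

definition point_density ::
    "'w measure \<Rightarrow> ('w \<Rightarrow> scalar_field) \<Rightarrow> real^3 \<Rightarrow> real \<Rightarrow> real \<Rightarrow> real" where
  "point_density M f x t a =
     enn2real (RN_deriv lborel (distr M lborel (\<lambda>\<omega>. f \<omega> x t)) a)"

definition joint_density ::
    "'w measure \<Rightarrow> ('w \<Rightarrow> scalar_field) \<Rightarrow> ('w \<Rightarrow> scalar_field) \<Rightarrow>
       real^3 \<Rightarrow> real \<Rightarrow> real^3 \<Rightarrow> real \<Rightarrow> real \<Rightarrow> real \<Rightarrow> real" where
  "joint_density M f h x t y s a b =
     enn2real (RN_deriv (lborel \<Otimes>\<^sub>M lborel)
       (distr M (lborel \<Otimes>\<^sub>M lborel) (\<lambda>\<omega>. (f \<omega> x t, h \<omega> y s))) (a, b))"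

definition ens_avg :: "'w measure \<Rightarrow> ('w \<Rightarrow> scalar_field) \<Rightarrow> scalar_field" where
  "ens_avg M f x t = (\<integral>a. a * point_density M f x t a \<partial>lborel)"

definition ens_corr ::
    "'w measure \<Rightarrow> ('w \<Rightarrow> scalar_field) \<Rightarrow> ('w \<Rightarrow> scalar_field) \<Rightarrow>
       real^3 \<Rightarrow> real \<Rightarrow> real^3 \<Rightarrow> real \<Rightarrow> real" where
  "ens_corr M f h x t y s =
     (\<integral>b. (\<integral>a. a * b * joint_density M f h x t y s a b \<partial>lborel) \<partial>lborel)"

definition ens_corr1 ::
    "'w measure \<Rightarrow> ('w \<Rightarrow> scalar_field) \<Rightarrow> ('w \<Rightarrow> scalar_field) \<Rightarrow> scalar_field" where
  "ens_corr1 M f h x t = ens_corr M f h x t x t"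

definition ens_avg_vec :: "'w measure \<Rightarrow> ('w \<Rightarrow> vector_field) \<Rightarrow> vector_field" where
  "ens_avg_vec M u x t = (\<chi> k. ens_avg M (\<lambda>\<omega>. vcomp (u \<omega>) k) x t)"

text \<open>
  The standard regularity condition for differentiating an expectation: near each point, the
  partial derivatives are bounded, along the coordinate lines through the point, by one
  integrable random variable.
\<close>

definition dominated_partial_derivs :: "'w measure \<Rightarrow> ('w \<Rightarrow> scalar_field) \<Rightarrow> bool" where
  "dominated_partial_derivs M f \<longleftrightarrow>
     (\<forall>x t. \<exists>g \<delta>. 0 < \<delta> \<and> integrable M g \<and>
        (AE \<omega> in M. \<forall>s. \<bar>s\<bar> < \<delta> \<longrightarrow>
           \<bar>time_deriv (f \<omega>) x (t + s)\<bar> \<le> g \<omega> \<and>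
           (\<forall>k. \<bar>space_deriv k (f \<omega>) (x + s *\<^sub>R axis k 1) t\<bar> \<le> g \<omega>)))"

end

theory Submission
  imports Defs "HOL-Real_Asymp.Real_Asymp"
begin

text \<open>
  Integrating against the density of a random variable is taking its expectation, so all ensemble
  averages and correlations turn into expectations over the underlying probability space.
  Dominated convergence, applied to difference quotients that the mean value theorem bounds,
  lets the expectation commute with partial derivatives. The identity is then linearity of the
  expectation together with adding and subtracting the averaged convection term.
\<close>

text \<open>Any density makes the law absolutely continuous, so its Radon-Nikodym derivative is a
  density too. The law is a finite measure, hence this derivative is finite almost everywhere, and
  the cut to real values by \<open>enn2real\<close> changes it only on a null set.\<close>

lemma (in prob_space) has_density_distr_RN_deriv:
  assumes "has_density M N X" and "sigma_finite_measure N"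
  shows "random_variable N X"
    and "distr M N X = density N (\<lambda>a. ennreal (enn2real (RN_deriv N (distr M N X) a)))"
proof -
  obtain p where p: "distributed M N X p"
    using assms(1) unfolding has_density_def by blast
  show X: "random_variable N X"
    using p by (rule distributed_measurable)
  interpret N: sigma_finite_measure N by fact
  interpret D: prob_space "distr M N X"
    using X by (rule prob_space_distr)
  have ac: "absolutely_continuous N (distr M N X)"
    using p by (auto simp: absolutely_continuousI_density distributed_distr_eq_density
        distributed_borel_measurable)
  have fin: "AE a in N. RN_deriv N (distr M N X) a \<noteq> \<infinity>"
    by (rule N.RN_deriv_finite[OF _ ac]) (simp_all add: D.sigma_finite_measure_axioms)
  have "distr M N X = density N (RN_deriv N (distr M N X))"
    by (rule N.density_RN_deriv[OF ac, symmetric]) simp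
  also have "\<dots> = density N (\<lambda>a. ennreal (enn2real (RN_deriv N (distr M N X) a)))"
    using fin by (intro density_cong) (auto simp: top.not_eq_extremum)
  finally show "distr M N X = density N (\<lambda>a. ennreal (enn2real (RN_deriv N (distr M N X) a)))" .
qed

text \<open>Change of variables to the law of \<open>X\<close>, followed by passage to its density.
  The equation is unconditional because both Bochner integrals take the default value 0 when
  integrability fails. The second claim supplies the integrability on the value space that Fubini's
  theorem requires.\<close>

lemma (in prob_space) expectation_eq_integral_RN_deriv:
  fixes h :: "'b \<Rightarrow> real"
  assumes "has_density M N X" and "sigma_finite_measure N" and [measurable]: "h \<in> borel_measurable N"
  shows "(\<integral>a. h a * enn2real (RN_deriv N (distr M N X) a) \<partial>N) = expectation (\<lambda>\<omega>. h (X \<omega>))"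
    and "integrable M (\<lambda>\<omega>. h (X \<omega>)) \<Longrightarrow>
      integrable N (\<lambda>a. h a * enn2real (RN_deriv N (distr M N X) a))"
proof -
  note [measurable] = has_density_distr_RN_deriv(1)[OF assms(1,2)]
  note D = has_density_distr_RN_deriv(2)[OF assms(1,2)]
  have "expectation (\<lambda>\<omega>. h (X \<omega>)) = integral\<^sup>L (distr M N X) h"
    by (rule integral_distr[symmetric]) measurable
  also have "\<dots> = (\<integral>a. enn2real (RN_deriv N (distr M N X) a) *\<^sub>R h a \<partial>N)"
    by (subst D, subst integral_density) auto
  finally show "(\<integral>a. h a * enn2real (RN_deriv N (distr M N X) a) \<partial>N) = expectation (\<lambda>\<omega>. h (X \<omega>))"
    by (simp add: mult.commute)
  assume "integrable M (\<lambda>\<omega>. h (X \<omega>))"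
  then have "integrable (distr M N X) h"
    by (subst integrable_distr_eq) auto
  then have "integrable N (\<lambda>a. enn2real (RN_deriv N (distr M N X) a) *\<^sub>R h a)"
    by (subst (asm) D, subst (asm) integrable_density) auto
  then show "integrable N (\<lambda>a. h a * enn2real (RN_deriv N (distr M N X) a))"
    by (simp add: mult.commute)
qed

lemma (in prob_space) ens_avg_eq_expectation:
  assumes "has_density M lborel (\<lambda>\<omega>. f \<omega> x t)"
  shows "ens_avg M f x t = expectation (\<lambda>\<omega>. f \<omega> x t)"
  unfolding ens_avg_def point_density_def
  using expectation_eq_integral_RN_deriv(1)[OF assms lborel.sigma_finite_measure_axioms,
      of "\<lambda>a. a"]
  by simp

text \<open>The correlation is an iterated integral, whereas the law of the pair lives on the
  product space. Fubini's theorem connects the two, and \<open>int\<close> provides the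
  integrability for it.\<close>

lemma (in prob_space) ens_corr1_eq_expectation:
  assumes dens: "has_density M (lborel \<Otimes>\<^sub>M lborel) (\<lambda>\<omega>. (f \<omega> x t, h \<omega> x t))"
    and int: "integrable M (\<lambda>\<omega>. f \<omega> x t * h \<omega> x t)"
  shows "ens_corr1 M f h x t = expectation (\<lambda>\<omega>. f \<omega> x t * h \<omega> x t)"
proof -
  have sf: "sigma_finite_measure (lborel \<Otimes>\<^sub>M lborel :: (real \<times> real) measure)"
    by (simp add: lborel_prod lborel.sigma_finite_measure_axioms)
  define p where "p = joint_density M f h x t x t"
  have p: "(\<lambda>z. fst z * snd z * enn2real (RN_deriv (lborel \<Otimes>\<^sub>M lborel)
       (distr M (lborel \<Otimes>\<^sub>M lborel) (\<lambda>\<omega>. (f \<omega> x t, h \<omega> x t))) z))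
      = (\<lambda>(a, b). a * b * p a b)"
    by (auto simp: p_def joint_density_def)
  note E = expectation_eq_integral_RN_deriv[OF dens sf, of "\<lambda>z. fst z * snd z", unfolded p fst_conv snd_conv]
  have "ens_corr1 M f h x t = (\<integral>b. (\<integral>a. a * b * p a b \<partial>lborel) \<partial>lborel)"
    by (simp add: ens_corr1_def ens_corr_def p_def)
  also have "\<dots> = integral\<^sup>L (lborel \<Otimes>\<^sub>M lborel) (\<lambda>(a, b). a * b * p a b)"
    by (rule lborel_pair.integral_snd) (use E(2) int in simp)
  also have "\<dots> = expectation (\<lambda>\<omega>. f \<omega> x t * h \<omega> x t)"
    by (rule E(1)) measurable
  finally show ?thesis .
qed

text \<open>Differentiation under the integral sign. The bound on the derivative passes to the
  difference quotients by the mean value inequality, and dominated convergence then gives the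
  limit.\<close>

lemma has_real_derivative_integral:
  fixes \<phi> :: "'w \<Rightarrow> real \<Rightarrow> real" and t \<delta> :: real
  assumes diff: "\<And>\<omega> s. \<omega> \<in> space M \<Longrightarrow> (\<phi> \<omega>) differentiable (at s)"
    and int: "\<And>s. integrable M (\<lambda>\<omega>. \<phi> \<omega> s)"
    and \<delta>: "0 < \<delta>"
    and g: "integrable M g"
    and bound: "AE \<omega> in M. \<forall>s. \<bar>s\<bar> < \<delta> \<longrightarrow> \<bar>deriv (\<phi> \<omega>) (t + s)\<bar> \<le> g \<omega>"
  shows "((\<lambda>s. \<integral>\<omega>. \<phi> \<omega> s \<partial>M) has_real_derivative (\<integral>\<omega>. deriv (\<phi> \<omega>) t \<partial>M)) (at t)"
    and "integrable M (\<lambda>\<omega>. deriv (\<phi> \<omega>) t)"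
proof -
  define q where "q \<omega> h = (\<phi> \<omega> (t + h) - \<phi> \<omega> t) / h" for \<omega> h
  have D: "(\<phi> \<omega> has_real_derivative deriv (\<phi> \<omega>) s) (at s)" if "\<omega> \<in> space M" for \<omega> s
    using diff[OF that] DERIV_deriv_iff_real_differentiable by blast
  have q_int: "integrable M (\<lambda>\<omega>. q \<omega> h)" for h
    unfolding q_def using int by auto
  have q_lim: "(q \<omega> \<longlongrightarrow> deriv (\<phi> \<omega>) t) (at 0)" if "\<omega> \<in> space M" for \<omega>
    using D[OF that, of t] unfolding q_def DERIV_def .
  \<comment> \<open>The exceptional null set is that of \<open>bound\<close> and does not depend on
    \<open>h\<close>, so one integrable \<open>g\<close> dominates all small difference quotients at
    once.\<close>
  have q_bound: "AE \<omega> in M. \<forall>h. h \<noteq> 0 \<longrightarrow> \<bar>h\<bar> < \<delta> \<longrightarrow> \<bar>q \<omega> h\<bar> \<le> g \<omega>"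
    using bound AE_space
  proof eventually_elim
    case (elim \<omega>)
    show ?case
    proof (intro allI impI)
      fix h :: real assume h: "h \<noteq> 0" "\<bar>h\<bar> < \<delta>"
      have "norm (\<phi> \<omega> (t + h) - \<phi> \<omega> t) \<le> g \<omega> * norm (t + h - t)"
      proof (rule field_differentiable_bound)
        show "convex (ball t \<delta>)" by simp
        show "(\<phi> \<omega> has_field_derivative deriv (\<phi> \<omega>) s) (at s within ball t \<delta>)" for s
          using D[OF elim(2)] by (rule has_field_derivative_at_within)
        show "norm (deriv (\<phi> \<omega>) s) \<le> g \<omega>" if "s \<in> ball t \<delta>" for s
          using elim(1)[rule_format, of "s - t"] that by (auto simp: dist_real_def)
      qed (use h \<delta> in \<open>auto simp: dist_real_def\<close>)
      then show "\<bar>q \<omega> h\<bar> \<le> g \<omega>"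
        using h by (simp add: q_def abs_divide divide_simps)
    qed
  qed
  \<comment> \<open>Dominated convergence is used along sequences. Measurability of the derivative
    is not assumed; it follows because the derivative is a pointwise limit of measurable
    quotients.\<close>
  have conv: "integrable M (\<lambda>\<omega>. deriv (\<phi> \<omega>) t) \<and>
      (\<lambda>n. \<integral>\<omega>. q \<omega> (h n) \<partial>M) \<longlonglongrightarrow> (\<integral>\<omega>. deriv (\<phi> \<omega>) t \<partial>M)"
    if h: "\<And>n. h n \<noteq> 0" "\<And>n. \<bar>h n\<bar> < \<delta>" "h \<longlonglongrightarrow> 0" for h :: "nat \<Rightarrow> real"
  proof -
    have lim: "(\<lambda>n. q \<omega> (h n)) \<longlonglongrightarrow> deriv (\<phi> \<omega>) t" if "\<omega> \<in> space M" for \<omega>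
      using q_lim[OF that] h unfolding tendsto_at_iff_sequentially by (auto simp: o_def)
    have [measurable]: "(\<lambda>\<omega>. deriv (\<phi> \<omega>) t) \<in> borel_measurable M"
      by (rule borel_measurable_LIMSEQ_real[OF lim]) (use q_int in auto)
    have le: "AE \<omega> in M. norm (q \<omega> (h n)) \<le> g \<omega>" for n
      using q_bound by eventually_elim (use h in auto)
    have limAE: "AE \<omega> in M. (\<lambda>n. q \<omega> (h n)) \<longlonglongrightarrow> deriv (\<phi> \<omega>) t"
      using lim by (intro AE_I2)
    show ?thesis
      by (intro conjI integrable_dominated_convergence[OF _ _ g limAE le]
          integral_dominated_convergence[OF _ _ g limAE le]) (use q_int in auto)
  qed
  \<comment> \<open>Integrability of the derivative needs just one admissible sequence. The offset 2
    keeps even the term at \<open>n = 0\<close> strictly below \<delta>.\<close>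
  have "(\<lambda>n. \<delta> / (2 + real n)) \<longlonglongrightarrow> 0"
    by real_asymp
  moreover have "\<bar>\<delta> / (2 + real n)\<bar> < \<delta>" "\<delta> / (2 + real n) \<noteq> 0" for n
    using \<delta> by (simp_all add: divide_simps add_pos_nonneg)
  ultimately show "integrable M (\<lambda>\<omega>. deriv (\<phi> \<omega>) t)"
    using conv[of "\<lambda>n. \<delta> / (2 + real n)"] by blast
  have "((\<lambda>h. \<integral>\<omega>. q \<omega> h \<partial>M) \<longlongrightarrow> (\<integral>\<omega>. deriv (\<phi> \<omega>) t \<partial>M)) (at 0)"
    unfolding tendsto_at_iff_sequentially o_def
  proof (intro allI impI)
    fix h :: "nat \<Rightarrow> real"
    assume h: "\<forall>n. h n \<in> UNIV - {0}" "h \<longlonglongrightarrow> 0"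
    then obtain N where N: "\<And>n. n \<ge> N \<Longrightarrow> \<bar>h n\<bar> < \<delta>"
      using \<delta> LIMSEQ_D by fastforce
    \<comment> \<open>\<open>conv\<close> requires every term to be below \<delta>, so the first
      \<open>N\<close> terms are dropped.\<close>
    have "(\<lambda>n. \<integral>\<omega>. q \<omega> (h (n + N)) \<partial>M) \<longlonglongrightarrow> (\<integral>\<omega>. deriv (\<phi> \<omega>) t \<partial>M)"
      using conv[of "\<lambda>n. h (n + N)"] h N LIMSEQ_ignore_initial_segment[OF h(2), of N] by auto
    then show "(\<lambda>n. \<integral>\<omega>. q \<omega> (h n) \<partial>M) \<longlonglongrightarrow> (\<integral>\<omega>. deriv (\<phi> \<omega>) t \<partial>M)"
      by (rule LIMSEQ_offset)
  qed
  moreover have "(\<integral>\<omega>. q \<omega> h \<partial>M) = ((\<integral>\<omega>. \<phi> \<omega> (t + h) \<partial>M) - (\<integral>\<omega>. \<phi> \<omega> t \<partial>M)) / h" for h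
    unfolding q_def using int by simp
  ultimately show "((\<lambda>s. \<integral>\<omega>. \<phi> \<omega> s \<partial>M) has_real_derivative (\<integral>\<omega>. deriv (\<phi> \<omega>) t \<partial>M)) (at t)"
    unfolding DERIV_def by simp
qed

text \<open>\<open>space_deriv\<close> differentiates at parameter 0 of a line based at the point
  itself. Moving the base point along the axis yields the derivative at any parameter of one fixed
  line, the form needed to apply the one-variable result.\<close>

lemma differentiable_along_axis:
  assumes "\<And>y. has_partial_derivs f y t"
  shows "(\<lambda>r. f (x + r *\<^sub>R axis k 1) t) differentiable (at s)"
    and "deriv (\<lambda>r. f (x + r *\<^sub>R axis k 1) t) s = space_deriv k f (x + s *\<^sub>R axis k 1) t"
proof -
  have "(\<lambda>r. f (x + s *\<^sub>R axis k 1 + r *\<^sub>R axis k 1) t) differentiable (at 0)"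
    using assms unfolding has_partial_derivs_def by blast
  then have "((\<lambda>r. f (x + (r + s) *\<^sub>R axis k 1) t) has_real_derivative
      space_deriv k f (x + s *\<^sub>R axis k 1) t) (at 0)"
    by (simp add: space_deriv_def DERIV_deriv_iff_real_differentiable algebra_simps)
  then have D: "((\<lambda>r. f (x + r *\<^sub>R axis k 1) t) has_real_derivative
      space_deriv k f (x + s *\<^sub>R axis k 1) t) (at s)"
    using DERIV_shift[of "\<lambda>r. f (x + r *\<^sub>R axis k 1) t" _ 0 s] by simp
  then show "(\<lambda>r. f (x + r *\<^sub>R axis k 1) t) differentiable (at s)"
    using real_differentiable_def by blast
  show "deriv (\<lambda>r. f (x + r *\<^sub>R axis k 1) t) s = space_deriv k f (x + s *\<^sub>R axis k 1) t"
    using D by (rule DERIV_imp_deriv)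
qed

text \<open>The one-variable result is applied on the time line and on each coordinate line through
  the point. Since \<open>deriv\<close> is total, differentiability of \<open>F\<close> is recorded
  separately so that its partial derivatives are genuine.\<close>

lemma partial_derivs_expectation:
  fixes f :: "'w \<Rightarrow> scalar_field"
  assumes diff: "\<And>\<omega> y s. \<omega> \<in> space M \<Longrightarrow> has_partial_derivs (f \<omega>) y s"
    and int: "\<And>y s. integrable M (\<lambda>\<omega>. f \<omega> y s)"
    and dom: "dominated_partial_derivs M f"
  defines "F \<equiv> \<lambda>y s. \<integral>\<omega>. f \<omega> y s \<partial>M"
  shows "has_partial_derivs F x t"
    and "time_deriv F x t = (\<integral>\<omega>. time_deriv (f \<omega>) x t \<partial>M)"
    and "space_deriv k F x t = (\<integral>\<omega>. space_deriv k (f \<omega>) x t \<partial>M)"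
    and "integrable M (\<lambda>\<omega>. time_deriv (f \<omega>) x t)"
proof -
  obtain g \<delta> where \<delta>: "0 < \<delta>" and g: "integrable M g" and
    b: "AE \<omega> in M. \<forall>s. \<bar>s\<bar> < \<delta> \<longrightarrow>
           \<bar>time_deriv (f \<omega>) x (t + s)\<bar> \<le> g \<omega> \<and>
           (\<forall>k. \<bar>space_deriv k (f \<omega>) (x + s *\<^sub>R axis k 1) t\<bar> \<le> g \<omega>)"
    using dom[unfolded dominated_partial_derivs_def, THEN spec, THEN spec, of x t]
    by (elim exE conjE)
  have tdiff: "(\<lambda>s. f \<omega> x s) differentiable (at s)" if "\<omega> \<in> space M" for \<omega> s
    using diff[OF that] unfolding has_partial_derivs_def by blast
  have tb: "AE \<omega> in M. \<forall>s. \<bar>s\<bar> < \<delta> \<longrightarrow> \<bar>deriv (\<lambda>s. f \<omega> x s) (t + s)\<bar> \<le> g \<omega>"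
    using b by eventually_elim (auto simp: time_deriv_def)
  note T = has_real_derivative_integral[where \<phi> = "\<lambda>\<omega> s. f \<omega> x s", OF tdiff int \<delta> g tb]
  show "integrable M (\<lambda>\<omega>. time_deriv (f \<omega>) x t)"
    using T(2) by (simp add: time_deriv_def)
  show "time_deriv F x t = (\<integral>\<omega>. time_deriv (f \<omega>) x t \<partial>M)"
    unfolding F_def time_deriv_def by (rule DERIV_imp_deriv[OF T(1)])
  have S: "((\<lambda>r. F (x + r *\<^sub>R axis k 1) t) has_real_derivative
      (\<integral>\<omega>. space_deriv k (f \<omega>) x t \<partial>M)) (at 0)" for k
  proof -
    have sb: "AE \<omega> in M. \<forall>s. \<bar>s\<bar> < \<delta> \<longrightarrow>
        \<bar>deriv (\<lambda>r. f \<omega> (x + r *\<^sub>R axis k 1) t) (0 + s)\<bar> \<le> g \<omega>"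
      using b AE_space by eventually_elim (simp add: differentiable_along_axis(2)[OF diff])
    have sdiff: "(\<lambda>r. f \<omega> (x + r *\<^sub>R axis k 1) t) differentiable (at s)" if "\<omega> \<in> space M" for \<omega> s
      using that by (intro differentiable_along_axis(1) diff)
    show ?thesis
      using has_real_derivative_integral(1)[where \<phi> = "\<lambda>\<omega> r. f \<omega> (x + r *\<^sub>R axis k 1) t",
          OF sdiff int \<delta> g sb]
      by (simp add: F_def space_deriv_def)
  qed
  show "space_deriv k F x t = (\<integral>\<omega>. space_deriv k (f \<omega>) x t \<partial>M)"
    using DERIV_imp_deriv[OF S] by (simp add: space_deriv_def)
  show "has_partial_derivs F x t"
    unfolding has_partial_derivs_def
    using T(1) S by (auto simp: F_def real_differentiable_def)
qed

theorem corollary8: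
  fixes M :: "'w measure" and u :: "'w \<Rightarrow> vector_field"
    and i :: 3 and x :: "real^3" and t :: real
  assumes "prob_space M"
    and "\<And>\<omega> j y s. \<omega> \<in> space M \<Longrightarrow> has_partial_derivs (vcomp (u \<omega>) j) y s"
    and "\<And>j y s. has_density M lborel (\<lambda>\<omega>. vcomp (u \<omega>) j y s)"
    and "\<And>j y s. has_density M lborel (\<lambda>\<omega>. material_deriv (u \<omega>) (vcomp (u \<omega>) j) y s)"
    and "\<And>j k y s. has_density M (lborel \<Otimes>\<^sub>M lborel)
           (\<lambda>\<omega>. (vcomp (u \<omega>) k y s, space_deriv k (vcomp (u \<omega>) j) y s))"
    and "\<And>j y s. integrable M (\<lambda>\<omega>. vcomp (u \<omega>) j y s)"
    and "\<And>j k y s. integrable M (\<lambda>\<omega>. vcomp (u \<omega>) k y s * space_deriv k (vcomp (u \<omega>) j) y s)"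
    and "\<And>j. dominated_partial_derivs M (\<lambda>\<omega>. vcomp (u \<omega>) j)"
  shows
    "ens_avg M (\<lambda>\<omega>. material_deriv (u \<omega>) (vcomp (u \<omega>) i)) x t =
       ens_avg M (\<lambda>\<omega> y s. time_deriv (vcomp (u \<omega>) i) y s
         + (\<Sum>k\<in>UNIV. vcomp (u \<omega>) k y s * space_deriv k (vcomp (u \<omega>) i) y s)) x t
     \<and> ens_avg M (\<lambda>\<omega> y s. time_deriv (vcomp (u \<omega>) i) y s
         + (\<Sum>k\<in>UNIV. vcomp (u \<omega>) k y s * space_deriv k (vcomp (u \<omega>) i) y s)) x t =
       material_deriv (ens_avg_vec M u) (ens_avg M (\<lambda>\<omega>. vcomp (u \<omega>) i)) x t
       + (\<Sum>k\<in>UNIV. ens_corr1 M (\<lambda>\<omega>. vcomp (u \<omega>) k) (\<lambda>\<omega>. space_deriv k (vcomp (u \<omega>) i)) x t)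
       - (\<Sum>k\<in>UNIV. ens_avg M (\<lambda>\<omega>. vcomp (u \<omega>) k) x t
           * space_deriv k (ens_avg M (\<lambda>\<omega>. vcomp (u \<omega>) i)) x t)
     \<and> material_deriv (ens_avg_vec M u) (ens_avg M (\<lambda>\<omega>. vcomp (u \<omega>) i)) x t =
       time_deriv (ens_avg M (\<lambda>\<omega>. vcomp (u \<omega>) i)) x t
       + (\<Sum>k\<in>UNIV. ens_avg M (\<lambda>\<omega>. vcomp (u \<omega>) k) x t
           * space_deriv k (ens_avg M (\<lambda>\<omega>. vcomp (u \<omega>) i)) x t)
     \<and> has_partial_derivs (ens_avg M (\<lambda>\<omega>. vcomp (u \<omega>) i)) x t"
proof -
  interpret prob_space M by fact
  let ?U = "ens_avg M (\<lambda>\<omega>. vcomp (u \<omega>) i)"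
  have avg: "ens_avg M (\<lambda>\<omega>. vcomp (u \<omega>) j) = (\<lambda>y s. expectation (\<lambda>\<omega>. vcomp (u \<omega>) j y s))" for j
    by (intro ext ens_avg_eq_expectation assms(3))
  note P = partial_derivs_expectation[where f = "\<lambda>\<omega>. vcomp (u \<omega>) i", OF assms(2,6,8), folded avg]
  \<comment> \<open>The first equality of the theorem is the definition of the material derivative,
    applied to each outcome.\<close>
  have fold_md: "ens_avg M (\<lambda>\<omega> y s. time_deriv (vcomp (u \<omega>) i) y s
         + (\<Sum>k\<in>UNIV. vcomp (u \<omega>) k y s * space_deriv k (vcomp (u \<omega>) i) y s))
      = ens_avg M (\<lambda>\<omega>. material_deriv (u \<omega>) (vcomp (u \<omega>) i))"
    by (simp add: material_deriv_def[abs_def])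
  have md: "material_deriv (ens_avg_vec M u) ?U x t = time_deriv ?U x t
      + (\<Sum>k\<in>UNIV. ens_avg M (\<lambda>\<omega>. vcomp (u \<omega>) k) x t * space_deriv k ?U x t)"
    by (simp add: material_deriv_def vcomp_def[of "ens_avg_vec M u"] ens_avg_vec_def)
  have "ens_avg M (\<lambda>\<omega>. material_deriv (u \<omega>) (vcomp (u \<omega>) i)) x t
      = expectation (\<lambda>\<omega>. material_deriv (u \<omega>) (vcomp (u \<omega>) i) x t)"
    by (rule ens_avg_eq_expectation[OF assms(4)])
  \<comment> \<open>Linearity needs each summand to be integrable: the time derivative is so by
    domination, the products by hypothesis.\<close>
  also have "\<dots> = expectation (\<lambda>\<omega>. time_deriv (vcomp (u \<omega>) i) x t)
      + (\<Sum>k\<in>UNIV. expectation (\<lambda>\<omega>. vcomp (u \<omega>) k x t * space_deriv k (vcomp (u \<omega>) i) x t))"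
    unfolding material_deriv_def using P(4) assms(7) by simp
  also have "\<dots> = time_deriv ?U x t
      + (\<Sum>k\<in>UNIV. ens_corr1 M (\<lambda>\<omega>. vcomp (u \<omega>) k) (\<lambda>\<omega>. space_deriv k (vcomp (u \<omega>) i)) x t)"
    using P(2) by (simp add: ens_corr1_eq_expectation[OF assms(5,7)])
  finally show ?thesis
    \<comment> \<open>By \<open>md\<close>, the averaged convection term inside the mean material
      derivative cancels the subtracted sum.\<close>
    using P(1) unfolding fold_md md by simp
qed

end
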